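(* Let $U_1,\dots,U_m$ ($m\ge 1$) be affine subspaces of $\mathbb{R}^n$ with nonempty intersection $S=\bigcap_{i=1}^m U_i$, and let $p_0\ge 0$ and $p_1,\dots,p_m>0$ satisfy $\sum_{i=0}^m p_i=1$. Let $T:\mathbb{R}^n\to\mathbb{R}^n$, $T(x)=p_0x+\sum_{i=1}^m p_iP_{U_i}(x)$. Then there exists a constant $r<1$ such that for every $x\in\mathbb{R}^n$, writing $s^\star=P_S(x)$, $$\|T(x)-s^\star\|\le r\,\|x-s^\star\|,$$ and therefore $$\|T^k(x)-s^\star\|\le r^k\,\|x-s^\star\|\quad\text{for all } k\ge 0.$$ In particular, the sequence $(T^k(x))_k$ converges linearly to $s^\star$, the projection of the initial point $x$ onto $S$.
   Context: $\mathbb{R}^n$ carries its standard inner product and Euclidean norm. For a nonempty closed convex set $C\subset\mathbb{R}^n$, $P_C(x)$ denotes the unique point of $C$ nearest to $x$. $T$ is the iteration operator of the F-SPM method (Framework for the Simultaneous Projection Method); the case $p_0=0$, $p_i=1/m$ is Cimmino's method. The iterates are $T^0(x)=x$ and $T^k(x)=T(T^{k-1}(x))$ for $k\ge1$. *)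

theory Defs
  imports "HOL-Analysis.Analysis"
begin

(* P_C is rendered by the library's closest_point C.  The weight p 0 belongs to the identity;
   p i and U i, for i in {1..m}, belong to the projections.  Values of p and U at other
   indices are irrelevant. *)
definition fspm_operator ::
    "nat \<Rightarrow> (nat \<Rightarrow> real) \<Rightarrow> (nat \<Rightarrow> 'a::euclidean_space set) \<Rightarrow> 'a \<Rightarrow> 'a" where
  "fspm_operator m p U x = p 0 *\<^sub>R x + (\<Sum>i=1..m. p i *\<^sub>R closest_point (U i) x)"

(* Linear convergence in the strong sense (Q-linear): the error shrinks by a factor of at most q
   in every step, which also yields norm (X k - L) \<le> q ^ k * norm (X 0 - L).  The case q = 0 is
   allowed, so sequences reaching L after one step qualify. *)
definition converges_linearly :: "(nat \<Rightarrow> 'a::real_normed_vector) \<Rightarrow> 'a \<Rightarrow> bool" where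
  "converges_linearly X L \<longleftrightarrow>
     X \<longlonglongrightarrow> L \<and> (\<exists>q. 0 \<le> q \<and> q < 1 \<and> (\<forall>k. norm (X (Suc k) - L) \<le> q * norm (X k - L)))"

end

theory Submission
  imports Defs
begin

text \<open>
  Choose \<open>a \<in> S\<close> and let \<open>V\<^sub>i = U\<^sub>i - a\<close>, \<open>W = \<Inter>V\<^sub>i\<close> be the direction spaces. Then
  \<open>T x - s = F (x - s)\<close> for every \<open>s \<in> S\<close>, where \<open>F = p\<^sub>0 I + \<Sum> p\<^sub>i P\<^bsub>V\<^sub>i\<^esub>\<close> is linear and maps \<open>W\<^sup>\<bottom>\<close>
  to itself. A unit vector \<open>v \<in> W\<^sup>\<bottom>\<close> lies outside some \<open>V\<^sub>i\<close>, so that \<open>\<parallel>P\<^bsub>V\<^sub>i\<^esub> v\<parallel> < 1\<close> and hence \<open>\<parallel>F v\<parallel> < 1\<close>;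
  compactness of the unit sphere of \<open>W\<^sup>\<bottom>\<close> gives a uniform \<open>r < 1\<close>. Finally, \<open>x - P\<^sub>S x\<close> lies in
  \<open>W\<^sup>\<bottom>\<close>, and the estimate can be iterated with the same \<open>s\<close>.
\<close>

section \<open>Projection onto an affine subspace, characterised by orthogonality\<close>

lemma closest_point_affine_orthogonal:
  fixes U :: "'a::euclidean_space set"
  assumes "affine U" "y \<in> U"
  shows "(x - closest_point U x) \<bullet> (y - closest_point U x) = 0"
proof -
  let ?c = "closest_point U x"
  have cl: "closed U" and cv: "convex U"
    using assms affine_closed affine_imp_convex by auto
  have c: "?c \<in> U" using closest_point_in_set cl assms by blast
  \<comment> \<open>The reflection of \<open>y\<close> through the projection stays in
    \<open>U\<close> by affinity. The obtuse-angle inequality of convex projection, applied to it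
    and to \<open>y\<close>, gives both signs and hence equality.\<close>
  have "2 *\<^sub>R ?c + (- 1) *\<^sub>R y \<in> U"
    by (rule mem_affine[OF assms(1) c assms(2)]) simp
  then have "(x - ?c) \<bullet> (2 *\<^sub>R ?c + (- 1) *\<^sub>R y - ?c) \<le> 0"
    by (rule closest_point_dot[OF cv cl])
  moreover have "2 *\<^sub>R ?c + (- 1) *\<^sub>R y - ?c = - (y - ?c)"
    by (simp add: scaleR_2)
  ultimately have "(x - ?c) \<bullet> (y - ?c) \<ge> 0"
    by (simp only: inner_minus_right)
  moreover have "(x - ?c) \<bullet> (y - ?c) \<le> 0"
    by (rule closest_point_dot[OF cv cl assms(2)])
  ultimately show ?thesis by linarith
qed

text \<open>Two points with the orthogonality property, each tested against the other, have squared
  distance 0. This turns every later computation of a projection into a check of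
  orthogonality.\<close>

lemma closest_point_affine_unique:
  fixes U :: "'a::euclidean_space set"
  assumes "affine U" "z \<in> U" "\<And>y. y \<in> U \<Longrightarrow> (x - z) \<bullet> (y - z) = 0"
  shows "closest_point U x = z"
proof -
  let ?c = "closest_point U x"
  have c: "?c \<in> U" using closest_point_in_set affine_closed assms by blast
  have "(x - ?c) \<bullet> (z - ?c) = 0"
    by (rule closest_point_affine_orthogonal[OF assms(1,2)])
  moreover have "(x - z) \<bullet> (?c - z) = 0" by (rule assms(3)[OF c])
  ultimately have "(z - ?c) \<bullet> (z - ?c) = 0"
    by (simp add: inner_diff_left inner_diff_right inner_commute)
  then show ?thesis by simp
qed

lemma closest_point_affine_shift:
  fixes U :: "'a::euclidean_space set"
  assumes "affine U" "a \<in> U"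
  shows "closest_point U x - a = closest_point ((\<lambda>u. u - a) ` U) (x - a)"
proof -
  let ?c = "closest_point U x"
  have c: "?c \<in> U" using closest_point_in_set affine_closed assms by blast
  have "affine ((\<lambda>u. u - a) ` U)"
    using affine_diffs_subspace_subtract[OF assms] subspace_imp_affine by blast
  then show ?thesis
  proof (rule closest_point_affine_unique[symmetric])
    show "?c - a \<in> (\<lambda>u. u - a) ` U" using c by blast
    fix y assume "y \<in> (\<lambda>u. u - a) ` U"
    then show "(x - a - (?c - a)) \<bullet> (y - (?c - a)) = 0"
      using closest_point_affine_orthogonal[OF assms(1)] by auto
  qed
qed

section \<open>Projection onto a linear subspace: linearity and norm\<close>

lemma closest_point_subspace_mem:
  fixes V :: "'a::euclidean_space set"
  assumes "subspace V"
  shows "closest_point V x \<in> V"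
  using assms closed_subspace closest_point_in_set subspace_0 by blast

lemma closest_point_subspace_orthogonal:
  fixes V :: "'a::euclidean_space set"
  assumes "subspace V" "y \<in> V"
  shows "(x - closest_point V x) \<bullet> y = 0"
  using closest_point_affine_orthogonal
    [OF subspace_imp_affine[OF assms(1)], of "y + closest_point V x" x]
    subspace_add[OF assms closest_point_subspace_mem[OF assms(1)]] by simp

lemma closest_point_subspace_unique:
  fixes V :: "'a::euclidean_space set"
  assumes "subspace V" "z \<in> V" "\<And>y. y \<in> V \<Longrightarrow> (x - z) \<bullet> y = 0"
  shows "closest_point V x = z"
  by (rule closest_point_affine_unique[OF subspace_imp_affine[OF assms(1)] assms(2)])
    (intro assms(3) subspace_diff[OF assms(1)] assms(2))

lemma linear_closest_point_subspace:
  fixes V :: "'a::euclidean_space set"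
  assumes V: "subspace V"
  shows "linear (closest_point V)"
proof (rule linearI)
  note mem = closest_point_subspace_mem[OF V] and orth = closest_point_subspace_orthogonal[OF V]
  fix x y :: 'a and c :: real
  show "closest_point V (x + y) = closest_point V x + closest_point V y"
  proof (rule closest_point_subspace_unique[OF V])
    fix z assume "z \<in> V"
    with orth[of z x] orth[of z y]
    show "(x + y - (closest_point V x + closest_point V y)) \<bullet> z = 0"
      by (simp add: inner_diff_left inner_add_left)
  qed (intro subspace_add[OF V] mem)
  show "closest_point V (c *\<^sub>R x) = c *\<^sub>R closest_point V x"
  proof (rule closest_point_subspace_unique[OF V])
    fix z assume "z \<in> V"
    with orth[of z x] show "(c *\<^sub>R x - c *\<^sub>R closest_point V x) \<bullet> z = 0"
      by (simp add: inner_diff_left)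
  qed (intro subspace_scale[OF V] mem)
qed

lemma norm_closest_point_subspace:
  fixes V :: "'a::euclidean_space set"
  assumes "subspace V"
  shows "(norm x)\<^sup>2 = (norm (closest_point V x))\<^sup>2 + (norm (x - closest_point V x))\<^sup>2"
proof -
  have "orthogonal (closest_point V x) (x - closest_point V x)"
    using closest_point_subspace_orthogonal[OF assms closest_point_subspace_mem[OF assms]]
    by (simp add: orthogonal_def inner_commute)
  from norm_add_Pythagorean[OF this] show ?thesis by simp
qed

lemma norm_closest_point_subspace_le:
  fixes V :: "'a::euclidean_space set"
  assumes "subspace V"
  shows "norm (closest_point V x) \<le> norm x"
  by (rule power2_le_imp_le) (simp_all add: norm_closest_point_subspace[OF assms, of x])

lemma norm_closest_point_subspace_less:
  fixes V :: "'a::euclidean_space set"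
  assumes "subspace V" "x \<notin> V"
  shows "norm (closest_point V x) < norm x"
proof -
  have "x \<noteq> closest_point V x"
    using closest_point_subspace_mem[OF assms(1), of x] assms(2) by auto
  then have "(norm (x - closest_point V x))\<^sup>2 > 0" by simp
  then have "(norm (closest_point V x))\<^sup>2 < (norm x)\<^sup>2"
    using norm_closest_point_subspace[OF assms(1), of x] by linarith
  then show ?thesis by (rule power2_less_imp_less) simp
qed

section \<open>The averaged operator for linear subspaces\<close>

lemma linear_fspm_operator:
  fixes V :: "nat \<Rightarrow> 'a::euclidean_space set"
  assumes "\<And>i. i \<in> {1..m} \<Longrightarrow> subspace (V i)"
  shows "linear (fspm_operator m p V)"
proof -
  have "linear (\<lambda>x. p 0 *\<^sub>R x + (\<Sum>i=1..m. p i *\<^sub>R closest_point (V i) x))"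
    by (rule linear_compose_add)
      (auto intro!: linear_compose_sum linear_compose_scale_right linear_scale_self
        linear_closest_point_subspace assms)
  then show ?thesis by (simp add: fspm_operator_def[abs_def])
qed

text \<open>Since \<open>w\<close> lies in every \<open>V i\<close>, each residual
  \<open>v - closest_point (V i) v\<close> is orthogonal to it, and so is each projection of
  \<open>v\<close>. This invariance keeps all iterates where the contraction estimate
  applies.\<close>

lemma fspm_operator_orthogonal:
  fixes V :: "nat \<Rightarrow> 'a::euclidean_space set"
  assumes V: "\<And>i. i \<in> {1..m} \<Longrightarrow> subspace (V i)"
    and w: "w \<in> (\<Inter>i\<in>{1..m}. V i)" and v: "v \<bullet> w = 0"
  shows "fspm_operator m p V v \<bullet> w = 0"
proof -
  have "closest_point (V i) v \<bullet> w = 0" if "i \<in> {1..m}" for i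
    using closest_point_subspace_orthogonal[OF V[OF that], of w v] w v that
    by (simp add: inner_diff_left)
  then show ?thesis
    using v by (simp add: fspm_operator_def inner_add_left inner_sum_left)
qed

lemma norm_fspm_operator_less:
  fixes V :: "nat \<Rightarrow> 'a::euclidean_space set"
  assumes V: "\<And>i. i \<in> {1..m} \<Longrightarrow> subspace (V i)"
    and p: "p 0 \<ge> 0" "\<And>i. i \<in> {1..m} \<Longrightarrow> p i > 0" "(\<Sum>i=0..m. p i) = 1"
    and v: "v \<notin> (\<Inter>i\<in>{1..m}. V i)"
  shows "norm (fspm_operator m p V v) < norm v"
proof -
  obtain j where j: "j \<in> {1..m}" "v \<notin> V j" using v by blast
  have "norm (fspm_operator m p V v)
      \<le> norm (p 0 *\<^sub>R v) + (\<Sum>i=1..m. norm (p i *\<^sub>R closest_point (V i) v))"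
    unfolding fspm_operator_def
    by (intro order.trans[OF norm_triangle_ineq] add_left_mono norm_sum)
  also have "\<dots> = p 0 * norm v + (\<Sum>i=1..m. p i * norm (closest_point (V i) v))"
    using p(1,2) by (simp add: less_imp_le)
  \<comment> \<open>All projections are nonexpansive, so a single strict summand is enough. The
    index \<open>j\<close> supplies it because its weight is positive.\<close>
  also have "\<dots> < p 0 * norm v + (\<Sum>i=1..m. p i * norm v)"
  proof (intro add_strict_left_mono sum_strict_mono_ex1 bexI[OF _ j(1)] ballI)
    show "p i * norm (closest_point (V i) v) \<le> p i * norm v" if "i \<in> {1..m}" for i
      using p(2)[OF that] norm_closest_point_subspace_le[OF V[OF that]] by simp
    show "p j * norm (closest_point (V j) v) < p j * norm v"
      using p(2)[OF j(1)] norm_closest_point_subspace_less[OF V j(2)] j(1) by simp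
  qed simp
  also have "\<dots> = (\<Sum>i=0..m. p i) * norm v"
    by (simp add: sum.atLeast_Suc_atMost sum_distrib_right distrib_right)
  finally show ?thesis using p(3) by simp
qed

lemma fspm_operator_contraction:
  fixes V :: "nat \<Rightarrow> 'a::euclidean_space set"
  assumes V: "\<And>i. i \<in> {1..m} \<Longrightarrow> subspace (V i)"
    and p: "p 0 \<ge> 0" "\<And>i. i \<in> {1..m} \<Longrightarrow> p i > 0" "(\<Sum>i=0..m. p i) = 1"
  obtains r where "0 \<le> r" "r < 1"
    "\<And>v. (\<And>w. w \<in> (\<Inter>i\<in>{1..m}. V i) \<Longrightarrow> v \<bullet> w = 0) \<Longrightarrow>
       norm (fspm_operator m p V v) \<le> r * norm v"
proof -
  define F where "F = fspm_operator m p V"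
  define W where "W = (\<Inter>i\<in>{1..m}. V i)"
  define K where "K = sphere 0 1 \<inter> (\<Inter>w\<in>W. {v. v \<bullet> w = 0})"
  have lin: "linear F" unfolding F_def by (rule linear_fspm_operator[OF V])
  have "closed {v. v \<bullet> w = 0}" for w :: 'a
    using closed_hyperplane[of w 0] by (simp add: inner_commute)
  then have K: "compact K" unfolding K_def by (intro compact_Int_closed closed_INT ballI) auto
  have "norm (F v) < 1" if "v \<in> K" for v
  proof -
    \<comment> \<open>Otherwise \<open>v\<close> would be orthogonal to itself, although its norm is
      1.\<close>
    have "v \<notin> W" using that unfolding K_def by auto
    then show ?thesis
      using norm_fspm_operator_less[of m V p v] V p that by (simp add: F_def W_def K_def)
  qed
  moreover have "continuous_on K (\<lambda>v. norm (F v))"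
    by (intro continuous_on_norm linear_continuous_on) (simp add: lin linear_conv_bounded_linear[symmetric])
  ultimately obtain r where r: "0 \<le> r" "r < 1" "\<And>v. v \<in> K \<Longrightarrow> norm (F v) \<le> r"
  proof (cases "K = {}")
    \<comment> \<open>There is no unit vector orthogonal to \<open>W\<close>, as when every
      \<open>V i\<close> is the whole space. No maximum exists then, and 0 serves as the
      constant.\<close>
    case True
    then show ?thesis using that[of 0] by auto
  next
    case False
    assume *: "\<And>v. v \<in> K \<Longrightarrow> norm (F v) < 1" "continuous_on K (\<lambda>v. norm (F v))"
    obtain u where "u \<in> K" "\<forall>v\<in>K. norm (F v) \<le> norm (F u)"
      using continuous_attains_sup[OF K False *(2)] by blast
    then show ?thesis using that[of "norm (F u)"] *(1) by auto
  qed
  have "norm (F v) \<le> r * norm v" if "\<And>w. w \<in> W \<Longrightarrow> v \<bullet> w = 0" for v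
  proof (cases "v = 0")
    case True
    then show ?thesis by (simp add: linear_0[OF lin])
  next
    case False
    \<comment> \<open>Normalising \<open>v\<close> puts it into \<open>K\<close>; linearity of
      \<open>F\<close> scales the bound back.\<close>
    then have "norm (F (inverse (norm v) *\<^sub>R v)) \<le> r"
      using that by (intro r(3)) (simp add: K_def)
    then show ?thesis
      using False by (simp add: linear_scale[OF lin] field_simps)
  qed
  then show thesis using that r(1,2) unfolding F_def W_def by blast
qed

section \<open>Passage from affine subspaces to their directions, and iteration\<close>

lemma fspm_operator_shift:
  fixes U :: "nat \<Rightarrow> 'a::euclidean_space set"
  assumes U: "\<And>i. i \<in> {1..m} \<Longrightarrow> affine (U i)"
    and s: "s \<in> (\<Inter>i\<in>{1..m}. U i)" and p: "(\<Sum>i=0..m. p i) = 1"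
  shows "fspm_operator m p U x - s = fspm_operator m p (\<lambda>i. (\<lambda>u. u - s) ` U i) (x - s)"
proof -
  \<comment> \<open>As the weights sum to 1, \<open>s\<close> can be split among the summands and
    each projection translated separately.\<close>
  have "s = (\<Sum>i=0..m. p i) *\<^sub>R s" using p by simp
  also have "\<dots> = p 0 *\<^sub>R s + (\<Sum>i=1..m. p i *\<^sub>R s)"
    by (simp add: sum.atLeast_Suc_atMost scaleR_left.sum scaleR_left_distrib)
  finally have "fspm_operator m p U x - s =
      p 0 *\<^sub>R (x - s) + (\<Sum>i=1..m. p i *\<^sub>R (closest_point (U i) x - s))"
    by (simp add: fspm_operator_def scaleR_diff_right sum_subtractf algebra_simps)
  also have "\<dots> = fspm_operator m p (\<lambda>i. (\<lambda>u. u - s) ` U i) (x - s)"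
    unfolding fspm_operator_def
    using closest_point_affine_shift[OF U] s by (intro arg_cong2[where f="(+)"] sum.cong) auto
  finally show ?thesis .
qed

text \<open>Holds because \<open>u - c\<close> equals \<open>(d + (u - c)) - d\<close>, where
  \<open>d + (u - c)\<close> is again in \<open>U\<close>. It allows \<open>r\<close> to be uniform
  in \<open>x\<close>: the direction spaces are fixed with one base point, while the limit varies
  with \<open>x\<close>.\<close>

lemma affine_diffs_eq:
  assumes "affine U" "a \<in> U" "b \<in> U"
  shows "(\<lambda>u. u - a) ` U = (\<lambda>u. u - b) ` U"
proof -
  have "(\<lambda>u. u - c) ` U \<subseteq> (\<lambda>u. u - d) ` U" if "c \<in> U" "d \<in> U" for c d
  proof clarify
    fix u assume "u \<in> U"
    from mem_affine_3_minus[OF assms(1) that(2) this that(1), of 1]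
    have "d + (u - c) \<in> U" by simp
    then show "u - c \<in> (\<lambda>u. u - d) ` U" by (rule rev_image_eqI) simp
  qed
  then show ?thesis using assms(2,3) by (intro subset_antisym)
qed

lemma linear_convergence_geometric:
  assumes "0 \<le> r" "r < 1" "\<And>k. norm (X (Suc k) - L) \<le> r * norm (X k - L)"
  shows "\<forall>k. norm (X k - L) \<le> r ^ k * norm (X 0 - L)" "converges_linearly X L"
proof -
  have *: "norm (X k - L) \<le> r ^ k * norm (X 0 - L)" for k
  proof (induction k)
    case (Suc k)
    have "norm (X (Suc k) - L) \<le> r * norm (X k - L)" by (rule assms(3))
    also have "\<dots> \<le> r * (r ^ k * norm (X 0 - L))"
      by (rule mult_left_mono[OF Suc assms(1)])
    finally show ?case by (simp add: mult.assoc)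
  qed simp
  then show "\<forall>k. norm (X k - L) \<le> r ^ k * norm (X 0 - L)" by blast
  have "(\<lambda>k. r ^ k * norm (X 0 - L)) \<longlonglongrightarrow> 0"
    using assms(1,2) by (intro tendsto_mult_left_zero LIMSEQ_power_zero) simp
  then have "(\<lambda>k. X k - L) \<longlonglongrightarrow> 0"
    by (rule Lim_null_comparison[rotated]) (simp add: *)
  then have "X \<longlonglongrightarrow> L" by (simp add: LIM_zero_iff)
  then show "converges_linearly X L"
    using assms by (auto simp: converges_linearly_def)
qed

theorem theorem2p11:
  fixes U :: "nat \<Rightarrow> (real ^ 'n) set"
    and p :: "nat \<Rightarrow> real"
    and m :: nat
  assumes "m \<ge> 1"
    and "\<And>i. i \<in> {1..m} \<Longrightarrow> affine (U i)"
    and "(\<Inter>i\<in>{1..m}. U i) \<noteq> {}"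
    and "p 0 \<ge> 0"
    and "\<And>i. i \<in> {1..m} \<Longrightarrow> p i > 0"
    and "(\<Sum>i=0..m. p i) = 1"
  shows "\<exists>r::real. 0 \<le> r \<and> r < 1 \<and>
    (\<forall>x. let T = fspm_operator m p U;
             s = closest_point (\<Inter>i\<in>{1..m}. U i) x
         in norm (T x - s) \<le> r * norm (x - s) \<and>
            (\<forall>k. norm ((T ^^ k) x - s) \<le> r ^ k * norm (x - s)) \<and>
            converges_linearly (\<lambda>k. (T ^^ k) x) s)"
proof -
  define S where "S = (\<Inter>i\<in>{1..m}. U i)"
  \<comment> \<open>The base point is chosen before \<open>x\<close>, so neither \<open>V\<close>
    nor \<open>r\<close> depends on \<open>x\<close>.\<close>
  obtain a where a: "a \<in> S" using assms(3) unfolding S_def by blast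
  define V where "V = (\<lambda>i. (\<lambda>u. u - a) ` U i)"
  have V: "subspace (V i)" if "i \<in> {1..m}" for i
    unfolding V_def by (rule affine_diffs_subspace_subtract) (use assms(2) that a in \<open>auto simp: S_def\<close>)
  obtain r where r: "0 \<le> r" "r < 1"
    and contr: "\<And>v. (\<And>w. w \<in> (\<Inter>i\<in>{1..m}. V i) \<Longrightarrow> v \<bullet> w = 0) \<Longrightarrow>
      norm (fspm_operator m p V v) \<le> r * norm v"
    using fspm_operator_contraction[where V=V and p=p and m=m, OF V assms(4-6)] by metis
  have S: "affine S" unfolding S_def by (intro affine_Inter) (use assms(2) in auto)
  have "norm (fspm_operator m p U x - s) \<le> r * norm (x - s) \<and>
      (\<forall>k. norm ((fspm_operator m p U ^^ k) x - s) \<le> r ^ k * norm (x - s)) \<and>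
      converges_linearly (\<lambda>k. (fspm_operator m p U ^^ k) x) s"
    if s_def: "s = closest_point S x" for x s
  proof -
    define X where "X = (\<lambda>k. (fspm_operator m p U ^^ k) x)"
    have s: "s \<in> S" using closest_point_in_set affine_closed S a s_def by blast
    have Vs: "V i = (\<lambda>u. u - s) ` U i" if "i \<in> {1..m}" for i
      unfolding V_def using affine_diffs_eq[OF assms(2)[OF that]] a s that by (auto simp: S_def)
    have "fspm_operator m p (\<lambda>i. (\<lambda>u. u - s) ` U i) v = fspm_operator m p V v" for v
      using Vs by (simp add: fspm_operator_def)
    then have step: "X (Suc k) - s = fspm_operator m p V (X k - s)" for k
      using fspm_operator_shift[OF assms(2) s[unfolded S_def] assms(6)] by (simp add: X_def)
    have "(X k - s) \<bullet> w = 0" if w: "w \<in> (\<Inter>i\<in>{1..m}. V i)" for k w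
    proof (induction k)
      case 0
      \<comment> \<open>A common direction \<open>w\<close> moves \<open>s\<close> within
        \<open>S\<close>, so orthogonality of the projection onto \<open>S\<close>, tested at
        \<open>s + w\<close>, gives \<open>(x - s) \<bullet> w = 0\<close>.\<close>
      have "s + w \<in> U i" if "i \<in> {1..m}" for i
        using w Vs that by fastforce
      then have "s + w \<in> S" by (simp add: S_def)
      from closest_point_affine_orthogonal[OF S this, of x]
      show ?case by (simp add: X_def s_def[symmetric])
    next
      case (Suc k)
      show ?case unfolding step by (rule fspm_operator_orthogonal[OF V w Suc])
    qed
    then have *: "norm (X (Suc k) - s) \<le> r * norm (X k - s)" for k
      unfolding step by (rule contr)
    show ?thesis
      using linear_convergence_geometric[of r X s, OF r *] *[of 0] by (simp add: X_def)
  qed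
  then show ?thesis
    using r unfolding Let_def S_def by blast
qed

end
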